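(* Let $X$ be a topological space and let $\mathscr{H}$ be an ideal in $X$. For a subset $A$ of $X$ suppose that $\mathrm{cl}_XA=X$ and $\mathrm{cl}_X(\mathscr{H}|_A)=\mathscr{H}$. If $A$ is connected modulo $\mathscr{H}|_A$, then $X$ is connected modulo $\mathscr{H}$.
   Context: An ideal in a set $X$ is a non-empty collection of subsets of $X$ closed under taking subsets and under binary unions (it need not be proper). The ideal $\langle\mathscr{A}\rangle$ in $X$ generated by a collection $\mathscr{A}$ of subsets of $X$ is the intersection of all ideals in $X$ containing $\mathscr{A}$. For an ideal $\mathscr{H}$ in a space $X$, a mapping $f:X\to[0,1]$ is $2$-valued modulo $\mathscr{H}$ if $f^{-1}(0)\notin\mathscr{H}$, $f^{-1}(1)\notin\mathscr{H}$ and $X\setminus(f^{-1}(0)\cup f^{-1}(1))\in\mathscr{H}$. The space $X$ is connected modulo $\mathscr{H}$ if there is no continuous $f:X\to[0,1]$ which is $2$-valued modulo $\mathscr{H}$. For a subset $A$ of $X$ (with the subspace topology), $\mathscr{H}|_A=\{H\cap A:H\in\mathscr{H}\}$, which is an ideal in $A$. For a collection $\mathscr{G}$ of subsets of $X$ (such as an ideal in $X$ or $\mathscr{H}|_A$), $\mathrm{cl}_X\mathscr{G}=\langle\mathrm{cl}_XG:G\in\mathscr{G}\rangle$, the ideal in $X$ generated by the closures in $X$ of the members of $\mathscr{G}$. *)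

theory Defs
  imports "HOL-Analysis.Analysis"
begin

text \<open>Ideals in a set \<open>S\<close> need not be proper.\<close>

definition ideal_in :: "'a set \<Rightarrow> 'a set set \<Rightarrow> bool" where
  "ideal_in S \<H> \<longleftrightarrow>
     \<H> \<noteq> {} \<and> \<H> \<subseteq> Pow S \<and>
     (\<forall>H\<in>\<H>. \<forall>B. B \<subseteq> H \<longrightarrow> B \<in> \<H>) \<and>
     (\<forall>G\<in>\<H>. \<forall>H\<in>\<H>. G \<union> H \<in> \<H>)"

definition ideal_generated :: "'a set \<Rightarrow> 'a set set \<Rightarrow> 'a set set" where
  "ideal_generated S \<A> = \<Inter> {\<I>. ideal_in S \<I> \<and> \<A> \<subseteq> \<I>}"

definition two_valued_modulo :: "'a topology \<Rightarrow> 'a set set \<Rightarrow> ('a \<Rightarrow> real) \<Rightarrow> bool" where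
  "two_valued_modulo X \<H> f \<longleftrightarrow>
     f \<in> topspace X \<rightarrow> {0..1} \<and>
     {x \<in> topspace X. f x = 0} \<notin> \<H> \<and>
     {x \<in> topspace X. f x = 1} \<notin> \<H> \<and>
     topspace X - ({x \<in> topspace X. f x = 0} \<union> {x \<in> topspace X. f x = 1}) \<in> \<H>"

definition connected_modulo :: "'a topology \<Rightarrow> 'a set set \<Rightarrow> bool" where
  "connected_modulo X \<H> \<longleftrightarrow>
     \<not> (\<exists>f. continuous_map X (top_of_set {0..1}) f \<and> two_valued_modulo X \<H> f)"

definition ideal_trace :: "'a set set \<Rightarrow> 'a set \<Rightarrow> 'a set set" where
  "ideal_trace \<H> A = {H \<inter> A |H. H \<in> \<H>}"

definition closure_ideal :: "'a topology \<Rightarrow> 'a set set \<Rightarrow> 'a set set" where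
  "closure_ideal X \<G> = ideal_generated (topspace X) {X closure_of G |G. G \<in> \<G>}"

end

theory Submission
  imports Defs
begin

text \<open>The restriction to \<open>A\<close> of a mapping that is 2-valued modulo \<open>\<H>\<close> is 2-valued modulo the
  trace of \<open>\<H>\<close>. The point is that a zero set cannot become negligible on \<open>A\<close>: otherwise, as the
  values other than 0 and 1 are negligible, the trace on \<open>A\<close> of the open set \<open>f < 1/2\<close> would be
  negligible too; its closure lies in \<open>\<H>\<close> and, by density of \<open>A\<close>, contains this open set.\<close>

lemma closure_ideal_superset:
  assumes "G \<in> \<G>"
  shows "X closure_of G \<in> closure_ideal X \<G>"
  using assms by (auto simp: closure_ideal_def ideal_generated_def)

lemma ideal_in_subset:
  assumes "ideal_in S \<H>" "H \<in> \<H>" "B \<subseteq> H"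
  shows "B \<in> \<H>"
  using assms unfolding ideal_in_def by blast

lemma ideal_in_Un:
  assumes "ideal_in S \<H>" "G \<in> \<H>" "H \<in> \<H>"
  shows "G \<union> H \<in> \<H>"
  using assms unfolding ideal_in_def by blast

text \<open>As \<open>\<H>\<close> is closed under subsets, each \<open>H \<inter> A\<close> is
  again in \<open>\<H>\<close>. Negligibility in \<open>A\<close> can thus be tested in
  \<open>\<H>\<close> itself.\<close>

lemma ideal_trace_eq:
  assumes "ideal_in S \<H>"
  shows "ideal_trace \<H> A = {H \<in> \<H>. H \<subseteq> A}"
proof -
  have "H \<inter> A \<in> \<H>" if "H \<in> \<H>" for H
    using ideal_in_subset[OF assms that] by blast
  then show ?thesis
    by (fastforce simp: ideal_trace_def)
qed

text \<open>Openness of \<open>U\<close> and density of \<open>A\<close> give that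
  \<open>U = U \<inter> cl A\<close> lies in the closure of \<open>U \<inter> A\<close>, and this
  closure is in \<open>\<H>\<close> by \<open>closed\<close>.\<close>

lemma open_in_ideal_if_trace:
  assumes "ideal_in (topspace X) \<H>"
    and dense: "X closure_of A = topspace X"
    and closed: "closure_ideal X (ideal_trace \<H> A) \<subseteq> \<H>"
    and "openin X U" "U \<inter> A \<in> \<H>"
  shows "U \<in> \<H>"
proof -
  have "U \<inter> A \<in> ideal_trace \<H> A"
    using assms(1,5) by (simp add: ideal_trace_eq)
  then have "X closure_of (U \<inter> A) \<in> \<H>"
    using closure_ideal_superset closed by blast
  moreover have "U \<subseteq> X closure_of (U \<inter> A)"
    using openin_Int_closure_of_subset[OF assms(4), of A] openin_subset[OF assms(4)] dense by auto
  ultimately show ?thesis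
    using assms(1) ideal_in_subset by blast
qed

text \<open>The open set \<open>W\<close> isolates \<open>c\<close> from the other element of
  \<open>{0, 1}\<close>, so that one argument serves both fibres.\<close>

lemma fibre_trace_notin_ideal:
  fixes f :: "'a \<Rightarrow> real"
  assumes "ideal_in (topspace X) \<H>"
    and "X closure_of A = topspace X"
    and "closure_ideal X (ideal_trace \<H> A) \<subseteq> \<H>"
    and f: "continuous_map X euclideanreal f"
    and rest: "topspace X - ({x \<in> topspace X. f x = 0} \<union> {x \<in> topspace X. f x = 1}) \<in> \<H>"
      (is "?R \<in> _")
    and W: "open W" "W \<inter> {0, 1} = {c}"
    and fibre: "{x \<in> topspace X. f x = c} \<notin> \<H>"
  shows "{x \<in> topspace X. f x = c} \<inter> A \<notin> \<H>"
proof
  assume "{x \<in> topspace X. f x = c} \<inter> A \<in> \<H>"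
  then have "({x \<in> topspace X. f x = c} \<inter> A) \<union> ?R \<in> \<H>"
    using ideal_in_Un[OF assms(1)] rest by blast
  \<comment> \<open>A value in \<open>W\<close> other than \<open>c\<close> is neither 0 nor 1, so
    such a point lies in \<open>?R\<close>.\<close>
  then have "{x \<in> topspace X. f x \<in> W} \<inter> A \<in> \<H>"
    by (rule ideal_in_subset[OF assms(1)]) (use W(2) in auto)
  moreover have "openin X {x \<in> topspace X. f x \<in> W}"
    using f W(1) by (simp add: continuous_map)
  ultimately have "{x \<in> topspace X. f x \<in> W} \<in> \<H>"
    using open_in_ideal_if_trace[OF assms(1-3)] by blast
  then have "{x \<in> topspace X. f x = c} \<in> \<H>"
    by (rule ideal_in_subset[OF assms(1)]) (use W(2) in auto)
  with fibre show False ..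
qed

theorem theorem2p14:
  fixes X :: "'a topology" and \<H> :: "'a set set" and A :: "'a set"
  assumes "ideal_in (topspace X) \<H>"
    and "A \<subseteq> topspace X"
    and "X closure_of A = topspace X"
    and "closure_ideal X (ideal_trace \<H> A) = \<H>"
    and "connected_modulo (subtopology X A) (ideal_trace \<H> A)"
  shows "connected_modulo X \<H>"
  unfolding connected_modulo_def
proof
  assume "\<exists>f. continuous_map X (top_of_set {0..1}) f \<and> two_valued_modulo X \<H> f"
  then obtain f :: "'a \<Rightarrow> real" where f: "continuous_map X (top_of_set {0..1}) f"
    and range: "f \<in> topspace X \<rightarrow> {0..1}"
    and zero: "{x \<in> topspace X. f x = 0} \<notin> \<H>"
    and one: "{x \<in> topspace X. f x = 1} \<notin> \<H>"
    and rest: "topspace X - ({x \<in> topspace X. f x = 0} \<union> {x \<in> topspace X. f x = 1}) \<in> \<H>"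
    unfolding two_valued_modulo_def by blast
  \<comment> \<open>With the whole real line as codomain, preimages of the open half-lines used
    below are open in \<open>X\<close>.\<close>
  have f': "continuous_map X euclideanreal f"
    using f continuous_map_into_fulltopology by blast
  have top: "topspace (subtopology X A) = A"
    using assms(2) by auto
  note fibre = fibre_trace_notin_ideal[OF assms(1,3) equalityD1[OF assms(4)] f' rest]
  have fibre_eq: "{x \<in> A. f x = c} = {x \<in> topspace X. f x = c} \<inter> A" for c
    using assms(2) by auto
  have "{x \<in> A. f x = 0} \<notin> \<H>"
    unfolding fibre_eq by (rule fibre[of "{..<1/2}"]) (use zero in auto)
  moreover have "{x \<in> A. f x = 1} \<notin> \<H>"
    unfolding fibre_eq by (rule fibre[of "{1/2<..}"]) (use one in auto)
  \<comment> \<open>This set is the part in \<open>A\<close> of the exceptional set of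
    \<open>rest\<close>.\<close>
  moreover have "A - ({x \<in> A. f x = 0} \<union> {x \<in> A. f x = 1}) \<in> \<H>"
    using rest by (rule ideal_in_subset[OF assms(1)]) (use assms(2) in auto)
  moreover have "f \<in> A \<rightarrow> {0..1}"
    using range assms(2) by blast
  ultimately have "two_valued_modulo (subtopology X A) (ideal_trace \<H> A) f"
    unfolding two_valued_modulo_def top ideal_trace_eq[OF assms(1)] by blast
  moreover have "continuous_map (subtopology X A) (top_of_set {0..1}) f"
    using f by (rule continuous_map_from_subtopology)
  ultimately show False
    using assms(5) unfolding connected_modulo_def by blast
qed

end
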